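(* Let $W$ and $\widetilde W$ be weight matrices of size $N$ on the same interval. If $\widetilde W$ is a Darboux transformation of $W$, then $\mathcal D(W)$ is a commutative algebra if and only if $\mathcal D(\widetilde W)$ is a commutative algebra.
   Context: A weight matrix of size $N$ on an interval $\mathcal I=(x_0,x_1)$ is a smooth function $W:\mathcal I\to \operatorname{Mat}_N(\mathbb C)$, positive definite almost everywhere, with finite moments of all orders. Standing assumption: for each $n\ge 0$ the derivative $W^{(n)}(x)$ decreases exponentially at infinity and there is a scalar polynomial $p_n(x)$ such that $W^{(n)}(x)p_n(x)$ has finite moments. The monic orthogonal polynomials $P_n$ of $W$ are the unique sequence in $\operatorname{Mat}_N(\mathbb C)[x]$ with $P_n$ monic of degree $n$ (leading coefficient $I$) and $\int_{x_0}^{x_1} P_n(x)W(x)P_m(x)^*\,dx=0$ for $n\ne m$. Differential operators $D=\sum_{j}\partial^jF_j(x)$, $\partial=\frac{d}{dx}$, act on the right on matrix-valued functions: $P(x)\cdot D=\sum_j \partial^j(P)(x)F_j(x)$; the product satisfies $P\cdot(D_1D_2)=(P\cdot D_1)\cdot D_2$. $\operatorname{Mat}_N(\Omega[x])$ is the algebra of such operators with all $F_j\in\operatorname{Mat}_N(\mathbb C)[x]$. $\mathcal D(W)$ is the algebra of all $D\in\operatorname{Mat}_N(\Omega[x])$ such that for every $n\ge0$ there is $\Lambda_n(D)\in\operatorname{Mat}_N(\mathbb C)$ with $P_n\cdot D=\Lambda_n(D)P_n$. An operator $\mathcal V\in\operatorname{Mat}_N(\Omega[x])$ is degree-preserving if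 $\deg(P\cdot\mathcal V)=\deg P$ for all $P\in\operatorname{Mat}_N(\mathbb C)[x]$. Darboux transformation: for weight matrices $W,\widetilde W$ of size $N$ on the same interval with monic orthogonal polynomials $P_n,\widetilde P_n$, $\widetilde W$ is a Darboux transformation of $W$ if there is $D\in\mathcal D(W)$ that factors as $D=\mathcal V\mathcal N$ with $\mathcal V,\mathcal N\in\operatorname{Mat}_N(\Omega[x])$ degree-preserving and such that $P_n\cdot\mathcal V=A_n\widetilde P_n$ for all $n\in\mathbb N_0$, for some matrices $A_n\in\operatorname{Mat}_N(\mathbb C)$. *)

theory Defs
  imports "HOL-Analysis.Analysis" "HOL-Computational_Algebra.Polynomial"
begin

section \<open>Matrix polynomials\<close>

text \<open>
  The ring of matrix polynomials is represented as the ring of matrices over the scalar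
  polynomials, so that its product is \<open>**\<close>; note that the product \<open>*\<close> of the library on
  vectors and matrices is the entrywise one.
\<close>

type_synonym 'n cmat = "complex ^ 'n ^ 'n"
type_synonym 'n pmat = "complex poly ^ 'n ^ 'n"

definition pmat_const :: "'n::finite cmat \<Rightarrow> 'n pmat" where
  "pmat_const A = (\<chi> i j. [:A $ i $ j:])"

definition pmat_coeff :: "'n::finite pmat \<Rightarrow> nat \<Rightarrow> 'n cmat" where
  "pmat_coeff P k = (\<chi> i j. coeff (P $ i $ j) k)"

definition pmat_eval :: "'n::finite pmat \<Rightarrow> complex \<Rightarrow> 'n cmat" where
  "pmat_eval P x = (\<chi> i j. poly (P $ i $ j) x)"

text \<open>As in the library for scalar polynomials, the degree of \<open>0\<close> is \<open>0\<close> here.\<close>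

definition pmat_degree :: "'n::finite pmat \<Rightarrow> nat" where
  "pmat_degree P = Max (range (\<lambda>(i, j). degree (P $ i $ j)))"

definition pmat_deriv :: "'n::finite pmat \<Rightarrow> 'n pmat" where
  "pmat_deriv P = (\<chi> i j. pderiv (P $ i $ j))"

definition conj_transpose :: "'n::finite cmat \<Rightarrow> 'n cmat" where
  "conj_transpose A = (\<chi> i j. cnj (A $ j $ i))"

subsection \<open>Auxiliary facts\<close>

lemma mm_add_right: "(B + C) ** A = B ** A + C ** A"
  for A B C :: "'a::semiring_1 ^ 'n::finite ^ 'n"
  by (vector matrix_matrix_mult_def sum.distrib[symmetric] field_simps)

lemma mm_zero [simp]: "A ** 0 = 0" "0 ** A = 0"
  for A :: "'a::semiring_1 ^ 'n::finite ^ 'n"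
  by (vector matrix_matrix_mult_def)+

lemma mm_minus: "(- A) ** B = - (A ** B)" "A ** (- B) = - (A ** B)"
  for A B :: "'a::ring_1 ^ 'n::finite ^ 'n"
  by (vector matrix_matrix_mult_def sum_negf)+

lemma mm_sum_left: "A ** (\<Sum>x\<in>S. f x) = (\<Sum>x\<in>S. A ** f x)"
  for A :: "'a::semiring_1 ^ 'n::finite ^ 'n" and f :: "'b \<Rightarrow> 'a ^ 'n ^ 'n"
  by (induction S rule: infinite_finite_induct) (auto simp: matrix_add_ldistrib)

lemma mm_sum_right: "(\<Sum>x\<in>S. f x) ** A = (\<Sum>x\<in>S. f x ** A)"
  for A :: "'a::semiring_1 ^ 'n::finite ^ 'n" and f :: "'b \<Rightarrow> 'a ^ 'n ^ 'n"
  by (induction S rule: infinite_finite_induct) (auto simp: mm_add_right)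

lemma mat_mult_entry: "(mat c ** A) $ i $ j = c * A $ i $ j"
  for A :: "'a::semiring_1 ^ 'n::finite ^ 'n"
  by (simp add: matrix_matrix_mult_def mat_def if_distrib if_distribR cong: if_cong)

lemma mat_mult_entry': "(A ** mat c) $ i $ j = A $ i $ j * c"
  for A :: "'a::semiring_1 ^ 'n::finite ^ 'n"
  by (simp add: matrix_matrix_mult_def mat_def if_distrib if_distribR cong: if_cong)

lemma mat_commute: "mat c ** A = A ** mat c"
  for A :: "'a::comm_semiring_1 ^ 'n::finite ^ 'n"
  by (simp add: vec_eq_iff mat_mult_entry mat_mult_entry' mult.commute)

lemma pmat_deriv_add: "pmat_deriv (P + Q) = pmat_deriv P + pmat_deriv Q"
  by (simp add: pmat_deriv_def vec_eq_iff pderiv_add)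

lemma pmat_deriv_minus: "pmat_deriv (- P) = - pmat_deriv P"
  by (simp add: pmat_deriv_def vec_eq_iff pderiv_minus)

lemma pmat_deriv_0 [simp]: "pmat_deriv 0 = 0"
  by (simp add: pmat_deriv_def vec_eq_iff)

lemma pderiv_sum: "pderiv (\<Sum>x\<in>S. f x) = (\<Sum>x\<in>S. pderiv (f x))"
  by (induction S rule: infinite_finite_induct) (auto simp: pderiv_add)

lemma pmat_deriv_mult: "pmat_deriv (P ** Q) = pmat_deriv P ** Q + P ** pmat_deriv Q"
  by (simp add: pmat_deriv_def vec_eq_iff matrix_matrix_mult_def pderiv_sum pderiv_mult
      sum.distrib algebra_simps)

lemma pmat_deriv_const [simp]: "pmat_deriv (pmat_const A) = 0"
  by (simp add: pmat_deriv_def pmat_const_def vec_eq_iff)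

lemma pmat_derivn_0 [simp]: "(pmat_deriv ^^ n) 0 = 0"
  by (induction n) auto

lemma pmat_derivn_add: "(pmat_deriv ^^ n) (P + Q) = (pmat_deriv ^^ n) P + (pmat_deriv ^^ n) Q"
  by (induction n) (auto simp: pmat_deriv_add)

lemma pmat_derivn_minus: "(pmat_deriv ^^ n) (- P) = - (pmat_deriv ^^ n) P"
  by (induction n) (auto simp: pmat_deriv_minus)

lemma pmat_derivn_sum: "(pmat_deriv ^^ n) (\<Sum>x\<in>S. f x) = (\<Sum>x\<in>S. (pmat_deriv ^^ n) (f x))"
  by (induction S rule: infinite_finite_induct) (auto simp: pmat_derivn_add)

lemma pmat_derivn_const_mult:
  "(pmat_deriv ^^ n) (pmat_const A ** P) = pmat_const A ** (pmat_deriv ^^ n) P"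
  by (induction n) (auto simp: pmat_deriv_mult)

lemma pmat_derivn_entry: "(pmat_deriv ^^ n) P $ i $ j = (pderiv ^^ n) (P $ i $ j)"
  by (induction n) (auto simp: pmat_deriv_def)

lemma pmat_Leibniz:
  "(pmat_deriv ^^ n) (P ** Q) =
     (\<Sum>k\<le>n. mat (of_nat (n choose k)) ** (pmat_deriv ^^ k) P ** (pmat_deriv ^^ (n - k)) Q)"
proof (induction n)
  case 0
  show ?case by simp
next
  case (Suc n)
  let ?p = "\<lambda>k. (pmat_deriv ^^ k) P" and ?q = "\<lambda>k. (pmat_deriv ^^ k) Q"
  let ?m = "\<lambda>k. mat (of_nat k) :: 'a pmat"
  have d: "pmat_deriv (?m c) = 0" for c
    by (simp add: vec_eq_iff pmat_deriv_def mat_def)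
  have m_add: "mat (a + b) = (mat a + mat b :: 'a pmat)" for a b :: "complex poly"
    by (simp add: mat_def vec_eq_iff)
  have "(pmat_deriv ^^ Suc n) (P ** Q) =
      (\<Sum>k\<le>n. pmat_deriv (?m (n choose k) ** (?p k ** ?q (n - k))))"
    using Suc pmat_derivn_sum[of 1] by (simp add: matrix_mul_assoc)
  also have "\<dots> = (\<Sum>k\<le>n. ?m (n choose k) ** ?p (Suc k) ** ?q (n - k)) +
      (\<Sum>k\<le>n. ?m (n choose k) ** ?p k ** ?q (Suc n - k))"
    by (simp add: d pmat_deriv_mult matrix_add_ldistrib sum.distrib matrix_mul_assoc Suc_diff_le)
  also have "(\<Sum>k\<le>n. ?m (n choose k) ** ?p k ** ?q (Suc n - k)) =
      (\<Sum>k\<le>Suc n. ?m (n choose k) ** ?p k ** ?q (Suc n - k))"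
    by (simp add: binomial_eq_0)
  also have "\<dots> = ?p 0 ** ?q (Suc n) +
      (\<Sum>k\<le>n. ?m (n choose Suc k) ** ?p (Suc k) ** ?q (n - k))"
    by (subst sum.atMost_Suc_shift) simp
  also have "(\<Sum>k\<le>n. ?m (n choose k) ** ?p (Suc k) ** ?q (n - k)) + \<dots> =
      ?p 0 ** ?q (Suc n) + (\<Sum>k\<le>n. ?m (Suc n choose Suc k) ** ?p (Suc k) ** ?q (n - k))"
    by (simp add: m_add mm_add_right sum.distrib)
  also have "\<dots> = (\<Sum>k\<le>Suc n. ?m (Suc n choose k) ** ?p k ** ?q (Suc n - k))"
    by (simp only: sum.atMost_Suc_shift[of _ n]) (simp del: binomial_Suc_Suc)
  finally show ?case .
qed

section \<open>Differential operators with matrix polynomial coefficients\<close>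

text \<open>The operator \<open>\<Sum>j. \<partial>^j F\<^sub>j\<close> is represented by its finitely supported coefficient sequence.\<close>

typedef ('n::finite) diffop = "{F :: nat \<Rightarrow> 'n pmat. finite {j. F j \<noteq> 0}}"
  morphisms op_coeff Abs_diffop
  by (rule exI[of _ "\<lambda>_. 0"]) simp

definition diffop_apply :: "'n::finite pmat \<Rightarrow> 'n diffop \<Rightarrow> 'n pmat" (infixl "\<cdot>" 70) where
  "P \<cdot> D = (\<Sum>j | op_coeff D j \<noteq> 0. (pmat_deriv ^^ j) P ** op_coeff D j)"

definition const_op :: "'n::finite pmat \<Rightarrow> 'n diffop" where
  "const_op F = Abs_diffop (\<lambda>j. if j = 0 then F else 0)"

text \<open>
  The product comes from the Leibniz rule:
  \<open>\<partial>^i F \<partial>^j G = \<Sum>k\<le>j. (j choose k) \<partial>^(i+k) (\<partial>^(j-k) F) G\<close> for operators acting on the right.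
\<close>

lemma finite_diffop_times:
  fixes F G :: "nat \<Rightarrow> 'n::finite pmat"
  assumes "finite {j. F j \<noteq> 0}" "finite {j. G j \<noteq> 0}"
  shows "finite {m. (\<Sum>j | G j \<noteq> 0. \<Sum>k\<le>min j m.
           mat (of_nat (j choose k)) ** (pmat_deriv ^^ (j - k)) (F (m - k)) ** G j) \<noteq> 0}"
proof (rule finite_subset)
  let ?S = "\<Union>j\<in>{j. G j \<noteq> 0}. (\<lambda>(i, k). i + k) ` ({i. F i \<noteq> 0} \<times> {..j})"
  show "finite ?S" using assms by auto
  show "{m. (\<Sum>j | G j \<noteq> 0. \<Sum>k\<le>min j m.
      mat (of_nat (j choose k)) ** (pmat_deriv ^^ (j - k)) (F (m - k)) ** G j) \<noteq> 0} \<subseteq> ?S"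
  proof
    fix m
    assume "m \<in> {m. (\<Sum>j | G j \<noteq> 0. \<Sum>k\<le>min j m.
      mat (of_nat (j choose k)) ** (pmat_deriv ^^ (j - k)) (F (m - k)) ** G j) \<noteq> 0}"
    then obtain j where j: "G j \<noteq> 0" "(\<Sum>k\<le>min j m.
      mat (of_nat (j choose k)) ** (pmat_deriv ^^ (j - k)) (F (m - k)) ** G j) \<noteq> 0"
      by (auto elim: sum.not_neutral_contains_not_neutral)
    then obtain k where k: "k \<le> min j m"
      "mat (of_nat (j choose k)) ** (pmat_deriv ^^ (j - k)) (F (m - k)) ** G j \<noteq> 0"
      by (auto elim: sum.not_neutral_contains_not_neutral)
    then have "F (m - k) \<noteq> 0" by auto
    with j(1) k(1) show "m \<in> ?S"
      by (auto intro!: bexI[of _ j] image_eqI[of _ _ "(m - k, k)"])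
  qed
qed

instantiation diffop :: (finite) "{zero, one, plus, minus, uminus, times}"
begin

definition zero_diffop :: "'a diffop" where "0 = Abs_diffop (\<lambda>_. 0)"

definition one_diffop :: "'a diffop" where "1 = const_op (mat 1)"

definition plus_diffop :: "'a diffop \<Rightarrow> 'a diffop \<Rightarrow> 'a diffop" where
  "D + E = Abs_diffop (\<lambda>j. op_coeff D j + op_coeff E j)"

definition uminus_diffop :: "'a diffop \<Rightarrow> 'a diffop" where
  "- D = Abs_diffop (\<lambda>j. - op_coeff D j)"

definition minus_diffop :: "'a diffop \<Rightarrow> 'a diffop \<Rightarrow> 'a diffop" where
  "D - E = D + - E" for D E :: "'a diffop"

definition times_diffop :: "'a diffop \<Rightarrow> 'a diffop \<Rightarrow> 'a diffop" where
  "D * E = Abs_diffop (\<lambda>m. \<Sum>j | op_coeff E j \<noteq> 0. \<Sum>k\<le>min j m.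
     mat (of_nat (j choose k)) ** (pmat_deriv ^^ (j - k)) (op_coeff D (m - k)) ** op_coeff E j)"

instance ..

end

lemma finite_op_coeff: "finite {j. op_coeff D j \<noteq> 0}"
  using op_coeff[of D] by simp

lemma op_coeff_Abs: "finite {j. F j \<noteq> 0} \<Longrightarrow> op_coeff (Abs_diffop F) = F"
  by (simp add: Abs_diffop_inverse)

lemma op_coeff_const_op: "op_coeff (const_op F) = (\<lambda>j. if j = 0 then F else 0)"
  unfolding const_op_def by (rule op_coeff_Abs, rule finite_subset[of _ "{0}"]) auto

lemma op_coeff_zero: "op_coeff 0 = (\<lambda>_. 0)"
  unfolding zero_diffop_def by (rule op_coeff_Abs) simp

lemma op_coeff_plus: "op_coeff (D + E) = (\<lambda>j. op_coeff D j + op_coeff E j)"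
  unfolding plus_diffop_def
  by (rule op_coeff_Abs,
      rule finite_subset[of _ "{j. op_coeff D j \<noteq> 0} \<union> {j. op_coeff E j \<noteq> 0}"])
    (auto simp: finite_op_coeff)

lemma op_coeff_uminus: "op_coeff (- D) = (\<lambda>j. - op_coeff D j)"
  unfolding uminus_diffop_def by (rule op_coeff_Abs) (simp add: finite_op_coeff)

lemma op_coeff_times:
  "op_coeff (D * E) = (\<lambda>m. \<Sum>j | op_coeff E j \<noteq> 0. \<Sum>k\<le>min j m.
     mat (of_nat (j choose k)) ** (pmat_deriv ^^ (j - k)) (op_coeff D (m - k)) ** op_coeff E j)"
  unfolding times_diffop_def
  by (intro op_coeff_Abs finite_diffop_times finite_op_coeff)

lemma diffop_apply_superset:
  assumes "finite S" "{j. op_coeff D j \<noteq> 0} \<subseteq> S"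
  shows "P \<cdot> D = (\<Sum>j\<in>S. (pmat_deriv ^^ j) P ** op_coeff D j)"
  unfolding diffop_apply_def using assms by (intro sum.mono_neutral_left) auto

lemma diffop_bound:
  obtains n where "\<And>j. j \<ge> n \<Longrightarrow> op_coeff D j = 0"
proof -
  obtain n where "\<forall>j\<in>{j. op_coeff D j \<noteq> 0}. j < n"
    using finite_op_coeff[of D] unfolding finite_nat_set_iff_bounded by blast
  then show ?thesis by (intro that[of n]) (meson leD mem_Collect_eq)
qed

lemma diffop_apply_bound:
  assumes "\<And>j. j \<ge> n \<Longrightarrow> op_coeff D j = 0"
  shows "P \<cdot> D = (\<Sum>j<n. (pmat_deriv ^^ j) P ** op_coeff D j)"
  using assms by (intro diffop_apply_superset) (auto simp: not_le[symmetric])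

lemma diffop_apply_add_left: "(P + Q) \<cdot> D = P \<cdot> D + Q \<cdot> D"
  by (simp add: diffop_apply_def pmat_derivn_add mm_add_right sum.distrib)

lemma diffop_apply_const_left: "(pmat_const A ** P) \<cdot> D = pmat_const A ** (P \<cdot> D)"
  by (simp add: diffop_apply_def pmat_derivn_const_mult mm_sum_left matrix_mul_assoc)

lemma diffop_apply_zero [simp]: "P \<cdot> 0 = 0"
  by (simp add: diffop_apply_def op_coeff_zero)

lemma diffop_apply_const_op [simp]: "P \<cdot> const_op F = P ** F"
  by (subst diffop_apply_superset[of "{0}"]) (auto simp: op_coeff_const_op)

lemma diffop_apply_one [simp]: "P \<cdot> 1 = P"
  by (simp add: one_diffop_def)

lemma diffop_apply_add: "P \<cdot> (D + E) = P \<cdot> D + P \<cdot> E"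
proof -
  let ?S = "{j. op_coeff D j \<noteq> 0} \<union> {j. op_coeff E j \<noteq> 0}"
  have "finite ?S" using finite_op_coeff by auto
  then show ?thesis
    by (subst (1 2 3) diffop_apply_superset[of ?S])
      (auto simp: op_coeff_plus matrix_add_ldistrib sum.distrib)
qed

lemma diffop_apply_uminus: "P \<cdot> (- D) = - (P \<cdot> D)"
  by (simp add: diffop_apply_def op_coeff_uminus mm_minus sum_negf)

lemma diffop_apply_mult: "P \<cdot> (D * E) = P \<cdot> D \<cdot> E"
proof -
  obtain nD where nD: "\<And>j. j \<ge> nD \<Longrightarrow> op_coeff D j = 0" using diffop_bound by blast
  obtain nE where nE: "\<And>j. j \<ge> nE \<Longrightarrow> op_coeff E j = 0" using diffop_bound by blast
  let ?M = "nD + nE"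
  let ?F = "op_coeff D" and ?G = "op_coeff E"
  let ?d = "\<lambda>k. pmat_deriv ^^ k"
  let ?c = "\<lambda>j k. mat (of_nat (j choose k)) :: 'a pmat"
  let ?J = "{j. ?G j \<noteq> 0}"
  have J: "j < nE" if "j \<in> ?J" for j using nE[of j] that by (auto simp: not_le[symmetric])
  have mv: "A ** (?c j k ** X ** Y) = ?c j k ** A ** X ** Y" for A X Y j k
    by (metis mat_commute matrix_mul_assoc)
  have big: "op_coeff (D * E) m = 0" if "m \<ge> ?M" for m
    unfolding op_coeff_times
  proof (intro sum.neutral ballI)
    fix j k assume "j \<in> ?J" "k \<in> {..min j m}"
    then have "m - k \<ge> nD" using J[of j] that by auto
    then show "?c j k ** ?d (j - k) (?F (m - k)) ** ?G j = 0" by (simp add: nD)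
  qed
  have "P \<cdot> (D * E) = (\<Sum>m<?M. ?d m P ** (\<Sum>j\<in>?J. \<Sum>k\<le>min j m.
      ?c j k ** ?d (j - k) (?F (m - k)) ** ?G j))"
    by (simp add: diffop_apply_bound[OF big] op_coeff_times)
  also have "\<dots> = (\<Sum>m<?M. \<Sum>j\<in>?J. \<Sum>k\<le>min j m.
      ?c j k ** ?d m P ** ?d (j - k) (?F (m - k)) ** ?G j)"
    by (simp only: mm_sum_left mv)
  also have "\<dots> = (\<Sum>j\<in>?J. \<Sum>m<?M. \<Sum>k\<le>min j m.
      ?c j k ** ?d m P ** ?d (j - k) (?F (m - k)) ** ?G j)"
    by (rule sum.swap)
  also have "\<dots> = (\<Sum>j\<in>?J. \<Sum>k\<le>j. \<Sum>i<nD.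
      ?c j k ** ?d (k + i) P ** ?d (j - k) (?F i) ** ?G j)"
  proof (rule sum.cong[OF refl])
    fix j assume j: "j \<in> ?J"
    have "(\<Sum>m<?M. \<Sum>k\<le>min j m. ?c j k ** ?d m P ** ?d (j - k) (?F (m - k)) ** ?G j) =
        (\<Sum>m<?M. \<Sum>k\<le>j. if k \<le> m then
           ?c j k ** ?d m P ** ?d (j - k) (?F (m - k)) ** ?G j else 0)"
      by (intro sum.cong[OF refl] sum.mono_neutral_cong_left) auto
    also have "\<dots> = (\<Sum>k\<le>j. \<Sum>m<?M. if k \<le> m then
           ?c j k ** ?d m P ** ?d (j - k) (?F (m - k)) ** ?G j else 0)"
      by (rule sum.swap)
    also have "\<dots> = (\<Sum>k\<le>j. \<Sum>i<nD. ?c j k ** ?d (k + i) P ** ?d (j - k) (?F i) ** ?G j)"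
    proof (rule sum.cong[OF refl])
      fix k assume k: "k \<in> {..j}"
      have sub: "(\<lambda>i. k + i) ` {..<nD} \<subseteq> {..<?M}" using J[OF j] k by auto
      have "(\<Sum>m<?M. if k \<le> m then
           ?c j k ** ?d m P ** ?d (j - k) (?F (m - k)) ** ?G j else 0) =
        (\<Sum>m\<in>(\<lambda>i. k + i) ` {..<nD}. ?c j k ** ?d m P ** ?d (j - k) (?F (m - k)) ** ?G j)"
      proof (rule sum.mono_neutral_cong_right[OF _ sub])
        show "\<forall>m\<in>{..<?M} - (\<lambda>i. k + i) ` {..<nD}. (if k \<le> m then
           ?c j k ** ?d m P ** ?d (j - k) (?F (m - k)) ** ?G j else 0) = 0"
        proof
          fix m assume m: "m \<in> {..<?M} - (\<lambda>i. k + i) ` {..<nD}"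
          have "m - k \<ge> nD" if "k \<le> m"
            using m that by (force simp: image_iff not_less[symmetric] dest: bspec[of _ _ "m - k"])
          then show "(if k \<le> m then
             ?c j k ** ?d m P ** ?d (j - k) (?F (m - k)) ** ?G j else 0) = 0"
            by (auto simp: nD)
        qed
      qed auto
      also have "\<dots> = (\<Sum>i<nD. ?c j k ** ?d (k + i) P ** ?d (j - k) (?F i) ** ?G j)"
        by (subst sum.reindex) auto
      finally show "(\<Sum>m<?M. if k \<le> m then
           ?c j k ** ?d m P ** ?d (j - k) (?F (m - k)) ** ?G j else 0) =
        (\<Sum>i<nD. ?c j k ** ?d (k + i) P ** ?d (j - k) (?F i) ** ?G j)" .
    qed
    finally show "(\<Sum>m<?M. \<Sum>k\<le>min j m. ?c j k ** ?d m P ** ?d (j - k) (?F (m - k)) ** ?G j) =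
      (\<Sum>k\<le>j. \<Sum>i<nD. ?c j k ** ?d (k + i) P ** ?d (j - k) (?F i) ** ?G j)" .
  qed
  also have "\<dots> = (\<Sum>j\<in>?J. \<Sum>i<nD. \<Sum>k\<le>j.
      ?c j k ** ?d (k + i) P ** ?d (j - k) (?F i) ** ?G j)"
    by (intro sum.cong[OF refl] sum.swap)
  also have "\<dots> = (\<Sum>j\<in>?J. ?d j (\<Sum>i<nD. ?d i P ** ?F i) ** ?G j)"
    by (simp add: pmat_derivn_sum pmat_Leibniz mm_sum_right funpow_add)
  also have "\<dots> = P \<cdot> D \<cdot> E"
    by (simp add: diffop_apply_bound[of nD D, OF nD] diffop_apply_def[of _ E])
  finally show ?thesis .
qed

lemma diffop_eqI:
  assumes "\<And>P. P \<cdot> D = P \<cdot> E"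
  shows "D = E"
proof -
  obtain nD where nD: "\<And>j. j \<ge> nD \<Longrightarrow> op_coeff D j = 0" using diffop_bound by blast
  obtain nE where nE: "\<And>j. j \<ge> nE \<Longrightarrow> op_coeff E j = 0" using diffop_bound by blast
  have "op_coeff D j = op_coeff E j" for j
  proof (induction j rule: less_induct)
    case (less j)
    let ?P = "mat (monom 1 j) :: 'a pmat"
    let ?n = "Suc (j + nD + nE)"
    have *: "?P \<cdot> A = (\<Sum>i<j. (pmat_deriv ^^ i) ?P ** op_coeff A i) +
        mat [:fact j:] ** op_coeff A j"
      if "\<And>i. i \<ge> ?n \<Longrightarrow> op_coeff A i = 0" for A
    proof -
      have z: "(pmat_deriv ^^ i) ?P = 0" if "i > j" for i
        using that
        by (simp add: vec_eq_iff pmat_derivn_entry mat_def coeff_higher_pderiv poly_eq_iff)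
      have f: "(pmat_deriv ^^ j) ?P = mat [:fact j:]"
        by (simp add: vec_eq_iff pmat_derivn_entry mat_def poly_eq_iff
            coeff_higher_pderiv coeff_pCons pochhammer_fact split: nat.split)
      have "?P \<cdot> A = (\<Sum>i<?n. (pmat_deriv ^^ i) ?P ** op_coeff A i)"
        by (rule diffop_apply_bound[OF that])
      also have "\<dots> = (\<Sum>i<Suc j. (pmat_deriv ^^ i) ?P ** op_coeff A i)"
        by (rule sum.mono_neutral_right) (auto simp: z)
      finally show ?thesis by (simp add: f)
    qed
    have "mat [:fact j:] ** op_coeff D j = mat [:fact j:] ** op_coeff E j"
      using assms[of ?P] *[of D] *[of E] nD nE less.IH by simp
    then show ?case by (simp add: vec_eq_iff mat_mult_entry poly_eq_iff)
  qed
  then show ?thesis by (metis op_coeff_inject ext)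
qed

instance diffop :: (finite) ring_1
proof
  fix D E G :: "'a diffop"
  show "(0::'a diffop) \<noteq> 1"
  proof
    assume "(0::'a diffop) = 1"
    then have "(mat 1 :: 'a pmat) = 0" 
      using diffop_apply_one[of "mat 1"] diffop_apply_zero[of "mat 1"] by metis
    then have "(mat 1 :: 'a pmat) $ i $ i = 0" for i by simp
    then show False by (simp add: mat_def)
  qed
qed (rule diffop_eqI; simp add: minus_diffop_def diffop_apply_add diffop_apply_uminus
     diffop_apply_mult diffop_apply_add_left algebra_simps)+

text \<open>
  The zero polynomial is treated separately because its degree is \<open>0\<close> here, whereas the
  convention \<open>deg 0 = -\<infinity>\<close> also forces a degree-preserving operator to be injective.
\<close>

definition degree_preserving :: "'n::finite diffop \<Rightarrow> bool" where
  "degree_preserving V \<longleftrightarrow>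
     (\<forall>P. pmat_degree (P \<cdot> V) = pmat_degree P \<and> (P \<cdot> V = 0 \<longleftrightarrow> P = 0))"

definition diffop_subalgebra :: "'n::finite diffop set \<Rightarrow> bool" where
  "diffop_subalgebra A \<longleftrightarrow> 1 \<in> A \<and> (\<forall>D\<in>A. \<forall>E\<in>A. D + E \<in> A \<and> D * E \<in> A) \<and>
     (\<forall>c :: complex. \<forall>D\<in>A. const_op (mat [:c:]) * D \<in> A)"

definition commutative_diffop_algebra :: "'n::finite diffop set \<Rightarrow> bool" where
  "commutative_diffop_algebra A \<longleftrightarrow>
     diffop_subalgebra A \<and> (\<forall>D\<in>A. \<forall>E\<in>A. D * E = E * D)"

section \<open>Weight matrices\<close>

definition higher_deriv :: "nat \<Rightarrow> (real \<Rightarrow> 'a) \<Rightarrow> real \<Rightarrow> 'a::real_normed_vector" where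
  "higher_deriv n f = ((\<lambda>g x. vector_derivative g (at x)) ^^ n) f"

definition smooth_on_open :: "real set \<Rightarrow> (real \<Rightarrow> 'a::real_normed_vector) \<Rightarrow> bool" where
  "smooth_on_open S f \<longleftrightarrow> open S \<and> (\<forall>n. \<forall>x\<in>S. higher_deriv n f differentiable (at x))"

definition pos_def :: "'n::finite cmat \<Rightarrow> bool" where
  "pos_def A \<longleftrightarrow> conj_transpose A = A \<and>
     (\<forall>v. v \<noteq> 0 \<longrightarrow> 0 < Re (\<Sum>i\<in>UNIV. \<Sum>j\<in>UNIV. cnj (v $ i) * A $ i $ j * v $ j))"

definition finite_moments :: "real set \<Rightarrow> (real \<Rightarrow> 'n::finite cmat) \<Rightarrow> bool" where
  "finite_moments S F \<longleftrightarrow> (\<forall>k. set_integrable lborel S (\<lambda>x. x ^ k *\<^sub>R F x))"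

text \<open>On a bounded interval the following condition is void.\<close>

definition exp_decreasing_at_infinity :: "real set \<Rightarrow> (real \<Rightarrow> 'n::finite cmat) \<Rightarrow> bool" where
  "exp_decreasing_at_infinity S F \<longleftrightarrow>
     (\<exists>C c R. c > 0 \<and> (\<forall>x\<in>S. \<bar>x\<bar> \<ge> R \<longrightarrow> norm (F x) \<le> C * exp (- c * \<bar>x\<bar>)))"

text \<open>
  The last conjunct is the standing regularity assumption on the derivatives of a weight;
  the scalar polynomials in it have to be nonzero for the assumption to say anything.
\<close>

definition weight_matrix :: "ereal \<Rightarrow> ereal \<Rightarrow> (real \<Rightarrow> 'n::finite cmat) \<Rightarrow> bool" where
  "weight_matrix a b W \<longleftrightarrow> a < b \<and>
     smooth_on_open (einterval a b) W \<and>
     (AE x in lborel. x \<in> einterval a b \<longrightarrow> pos_def (W x)) \<and>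
     finite_moments (einterval a b) W \<and>
     (\<forall>n. exp_decreasing_at_infinity (einterval a b) (higher_deriv n W) \<and>
        (\<exists>p :: complex poly. p \<noteq> 0 \<and>
           finite_moments (einterval a b)
             (\<lambda>x. mat (poly p (of_real x)) ** higher_deriv n W x)))"

section \<open>Orthogonal polynomials, the algebra of a weight, Darboux transformations\<close>

definition weight_inner ::
    "ereal \<Rightarrow> ereal \<Rightarrow> (real \<Rightarrow> 'n::finite cmat) \<Rightarrow> 'n pmat \<Rightarrow> 'n pmat \<Rightarrow> 'n cmat" where
  "weight_inner a b W P Q =
     (LINT x:einterval a b|lborel.
        pmat_eval P (of_real x) ** W x ** conj_transpose (pmat_eval Q (of_real x)))"

definition monic_orthogonal ::
    "ereal \<Rightarrow> ereal \<Rightarrow> (real \<Rightarrow> 'n::finite cmat) \<Rightarrow> (nat \<Rightarrow> 'n pmat) \<Rightarrow> bool" where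
  "monic_orthogonal a b W P \<longleftrightarrow>
     (\<forall>n. pmat_degree (P n) = n \<and> pmat_coeff (P n) n = mat 1) \<and>
     (\<forall>n m. n \<noteq> m \<longrightarrow> weight_inner a b W (P n) (P m) = 0)"

definition mops :: "ereal \<Rightarrow> ereal \<Rightarrow> (real \<Rightarrow> 'n::finite cmat) \<Rightarrow> nat \<Rightarrow> 'n pmat" where
  "mops a b W = (THE P. monic_orthogonal a b W P)"

definition weight_algebra :: "ereal \<Rightarrow> ereal \<Rightarrow> (real \<Rightarrow> 'n::finite cmat) \<Rightarrow> 'n diffop set" where
  "weight_algebra a b W =
     {D. \<forall>n. \<exists>\<Lambda>. mops a b W n \<cdot> D = pmat_const \<Lambda> ** mops a b W n}"

definition darboux_transformation ::
    "ereal \<Rightarrow> ereal \<Rightarrow> (real \<Rightarrow> 'n::finite cmat) \<Rightarrow> (real \<Rightarrow> 'n cmat) \<Rightarrow> bool" where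
  "darboux_transformation a b W W' \<longleftrightarrow>
     (\<exists>D\<in>weight_algebra a b W. \<exists>V N. D = V * N \<and>
        degree_preserving V \<and> degree_preserving N \<and>
        (\<exists>A. \<forall>n. mops a b W n \<cdot> V = pmat_const (A n) ** mops a b W' n))"

lemma pmat_const_add: "pmat_const (A + B) = pmat_const A + pmat_const B"
  by (simp add: pmat_const_def vec_eq_iff)

lemma pmat_const_mult: "pmat_const (A ** B) = pmat_const A ** pmat_const B"
proof -
  have "[:sum f S:] = (\<Sum>x\<in>S. [:f x:])" for f :: "'a \<Rightarrow> complex" and S
    by (simp add: poly_eq_iff coeff_sum coeff_pCons split: nat.split)
  then show ?thesis
    by (simp add: pmat_const_def vec_eq_iff matrix_matrix_mult_def mult.commute)
qed

lemma pmat_const_mat: "pmat_const (mat c) = mat [:c:]"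
  by (simp add: pmat_const_def vec_eq_iff mat_def)

lemma diffop_subalgebra_weight_algebra: "diffop_subalgebra (weight_algebra a b W)"
proof -
  let ?A = "weight_algebra a b W" and ?P = "mops a b W"
  have "1 \<in> ?A"
    unfolding weight_algebra_def
    by (auto intro!: exI[of _ "mat 1"] simp: pmat_const_mat pCons_one)
  moreover have "D + E \<in> ?A" "D * E \<in> ?A" if DE: "D \<in> ?A" "E \<in> ?A" for D E
  proof -
    obtain L M where "\<And>n. ?P n \<cdot> D = pmat_const (L n) ** ?P n"
      "\<And>n. ?P n \<cdot> E = pmat_const (M n) ** ?P n"
      using DE unfolding weight_algebra_def by (auto dest!: choice)
    then have "\<And>n. ?P n \<cdot> (D + E) = pmat_const (L n + M n) ** ?P n"
      "\<And>n. ?P n \<cdot> (D * E) = pmat_const (L n ** M n) ** ?P n"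
      by (simp_all add: diffop_apply_add diffop_apply_mult diffop_apply_const_left
          pmat_const_add pmat_const_mult mm_add_right matrix_mul_assoc)
    then show "D + E \<in> ?A" "D * E \<in> ?A" unfolding weight_algebra_def by blast+
  qed
  moreover have "const_op (mat [:c:]) * D \<in> ?A" if D: "D \<in> ?A" for c D
  proof -
    obtain L where "\<And>n. ?P n \<cdot> D = pmat_const (L n) ** ?P n"
      using D unfolding weight_algebra_def by (auto dest!: choice)
    then have "?P n \<cdot> (const_op (mat [:c:]) * D) = pmat_const (mat c ** L n) ** ?P n" for n
      using diffop_apply_const_left[of "mat c" "?P n" D] mat_commute[of "[:c:]" "?P n"]
      by (simp add: diffop_apply_mult pmat_const_mult pmat_const_mat matrix_mul_assoc)
    then show ?thesis unfolding weight_algebra_def by blast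
  qed
  ultimately show ?thesis unfolding diffop_subalgebra_def by blast
qed

end

theory Submission
  imports Defs
begin

text \<open>
  Let \<open>P\<^sub>n\<close> and \<open>Q\<^sub>n\<close> be the monic orthogonal polynomials of \<open>W\<close> and \<open>W'\<close>, and let
  \<open>D = V N\<close> be the factorization behind the Darboux transformation, so that
  \<open>P\<^sub>n \<cdot> V = A\<^sub>n Q\<^sub>n\<close>. As \<open>V\<close> preserves degrees, every \<open>A\<^sub>n\<close> is invertible, and comparing with
  \<open>P\<^sub>n \<cdot> V N = \<Lambda>\<^sub>n P\<^sub>n\<close> gives \<open>Q\<^sub>n \<cdot> N = A\<^sub>n\<inverse> \<Lambda>\<^sub>n P\<^sub>n\<close> (\<open>intertwines_factor\<close>). So \<open>V\<close> carries
  the first sequence to the second one and \<open>N\<close> carries it back. The situation is symmetric in the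
  two weights, and it is enough to transfer commutativity from \<open>W\<close> to \<open>W'\<close>.

  For that, \<open>E \<mapsto> V E N\<close> maps the algebra of \<open>W'\<close> into that of \<open>W\<close>. It is not multiplicative,
  but commutativity of its image together with \<open>V N\<close> first makes \<open>N V\<close> commute with the algebra
  of \<open>W'\<close>, and then the whole algebra commutative (\<open>commute_transfer\<close>). These deductions cancel
  \<open>V\<close> and \<open>N\<close> on either side: on the right because they have trivial kernel, on the left because
  the \<open>A\<^sub>n\<close> are invertible and an operator is determined by its values on a monic sequence.

  The analytic input is that each weight has a unique monic orthogonal sequence; without it, the
  polynomials \<open>mops a b W n\<close> need not be monic. It follows by the Gram--Schmidt process from the
  definiteness of the inner product (\<open>inner_definite\<close>).
\<close>

section \<open>Matrix polynomials and their leading coefficients\<close>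

lemma pmat_eq_iff_coeff: "P = Q \<longleftrightarrow> (\<forall>k. pmat_coeff P k = pmat_coeff Q k)"
  by (auto simp: pmat_coeff_def vec_eq_iff poly_eq_iff)

lemma pmat_coeff_add: "pmat_coeff (P + Q) k = pmat_coeff P k + pmat_coeff Q k"
  by (simp add: pmat_coeff_def vec_eq_iff)

lemma pmat_coeff_diff: "pmat_coeff (P - Q) k = pmat_coeff P k - pmat_coeff Q k"
  by (simp add: pmat_coeff_def vec_eq_iff)

lemma pmat_coeff_zero [simp]: "pmat_coeff 0 k = 0"
  by (simp add: pmat_coeff_def vec_eq_iff)

lemma pmat_coeff_const_mult: "pmat_coeff (pmat_const A ** P) k = A ** pmat_coeff P k"
  by (simp add: pmat_coeff_def pmat_const_def vec_eq_iff matrix_matrix_mult_def coeff_sum)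

lemma pmat_coeff_monom: "pmat_coeff (mat (monom 1 n)) k = (if k = n then mat 1 else 0)"
  by (simp add: pmat_coeff_def vec_eq_iff mat_def)

lemma pmat_const_zero [simp]: "pmat_const 0 = 0"
  by (simp add: pmat_const_def vec_eq_iff)

lemma pmat_degree_le_iff: "pmat_degree P \<le> n \<longleftrightarrow> (\<forall>k>n. pmat_coeff P k = 0)"
proof -
  have "pmat_degree P \<le> n \<longleftrightarrow> (\<forall>i j. degree (P $ i $ j) \<le> n)"
    unfolding pmat_degree_def by (subst Max_le_iff) auto
  also have "\<dots> \<longleftrightarrow> (\<forall>i j. \<forall>k>n. coeff (P $ i $ j) k = 0)"
    by (meson coeff_eq_0 degree_le le_less_trans)
  also have "\<dots> \<longleftrightarrow> (\<forall>k>n. pmat_coeff P k = 0)"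
    by (auto simp: pmat_coeff_def vec_eq_iff)
  finally show ?thesis .
qed

definition monic :: "nat \<Rightarrow> 'n::finite pmat \<Rightarrow> bool" where
  "monic n P \<longleftrightarrow> pmat_degree P = n \<and> pmat_coeff P n = mat 1"

lemma mat_one_nonzero: "(mat 1 :: 'n::finite cmat) \<noteq> 0"
  by (simp add: mat_def vec_eq_iff)

lemma monic_iff: "monic n P \<longleftrightarrow> pmat_coeff P n = mat 1 \<and> (\<forall>k>n. pmat_coeff P k = 0)"
proof -
  have "n \<le> pmat_degree P" if "pmat_coeff P n = mat 1"
    using that pmat_degree_le_iff[of P "pmat_degree P"] mat_one_nonzero
    by (metis le_refl not_le)
  then show ?thesis
    unfolding monic_def pmat_degree_le_iff[symmetric] by auto
qed

lemma monic_monom: "monic n (mat (monom 1 n))"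
  by (simp add: monic_iff pmat_coeff_monom)

text \<open>
  \<open>degree_below n\<close> are the polynomials of degree less than \<open>n\<close>; unlike a bound on
  \<open>pmat_degree\<close>, the case \<open>n = 0\<close> is the zero polynomial alone, which starts the inductions.
\<close>

definition degree_below :: "nat \<Rightarrow> 'n::finite pmat \<Rightarrow> bool" where
  "degree_below n P \<longleftrightarrow> (\<forall>k\<ge>n. pmat_coeff P k = 0)"

lemma degree_below_0: "degree_below 0 P \<longleftrightarrow> P = 0"
  by (auto simp: degree_below_def pmat_eq_iff_coeff)

lemma degree_below_mono: "degree_below m P \<Longrightarrow> m \<le> n \<Longrightarrow> degree_below n P"
  by (auto simp: degree_below_def)

lemma degree_below_exists: "\<exists>n. degree_below n P"
  using pmat_degree_le_iff[of P "pmat_degree P"]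
  by (auto simp: degree_below_def intro!: exI[of _ "Suc (pmat_degree P)"])

lemma degree_below_add: "degree_below n P \<Longrightarrow> degree_below n Q \<Longrightarrow> degree_below n (P + Q)"
  by (simp add: degree_below_def pmat_coeff_add)

lemma monic_degree_below: "monic m P \<Longrightarrow> m < n \<Longrightarrow> degree_below n (pmat_const A ** P)"
  by (auto simp: degree_below_def monic_iff pmat_coeff_const_mult)

lemma monic_diff_below: "monic n P \<Longrightarrow> degree_below n S \<Longrightarrow> monic n (P - S)"
  by (auto simp: degree_below_def monic_iff pmat_coeff_diff)

lemma monic_diff_monic: "monic n P \<Longrightarrow> monic n Q \<Longrightarrow> degree_below n (P - Q)"
  unfolding degree_below_def monic_iff pmat_coeff_diff
  by (metis diff_self le_neq_implies_less)

text \<open>Division by a monic polynomial of the same degree strips the leading coefficient.\<close>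

lemma degree_below_Suc_split:
  assumes "degree_below (Suc n) Q" "monic n P"
  obtains R where "degree_below n R" "Q = pmat_const (pmat_coeff Q n) ** P + R"
proof
  let ?R = "Q - pmat_const (pmat_coeff Q n) ** P"
  show "degree_below n ?R"
    unfolding degree_below_def
  proof (intro allI impI)
    fix k assume "n \<le> k"
    then consider "k = n" | "k \<ge> Suc n" by linarith
    then show "pmat_coeff ?R k = 0"
      using assms
      by cases (auto simp: degree_below_def monic_iff pmat_coeff_diff pmat_coeff_const_mult)
  qed
qed simp

text \<open>
  A monic sequence is a basis of the left module of matrix polynomials, so an induction on the
  degree proves a property of all polynomials from its closure under left combinations.
\<close>

lemma monic_sequence_induct [consumes 1, case_names zero add]:
  assumes "\<And>n. monic n (P n)"
    and "\<Phi> 0" and "\<And>A n R. \<Phi> R \<Longrightarrow> \<Phi> (pmat_const A ** P n + R)"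
  shows "\<Phi> Q"
proof -
  obtain n where "degree_below n Q" using degree_below_exists by blast
  then show ?thesis
  proof (induction n arbitrary: Q)
    case 0
    then show ?case using assms(2) by (simp add: degree_below_0)
  next
    case (Suc n)
    then obtain R where "degree_below n R" "Q = pmat_const (pmat_coeff Q n) ** P n + R"
      using degree_below_Suc_split[OF Suc.prems assms(1)] by blast
    then show ?case using Suc.IH assms(3) by metis
  qed
qed

lemma diffop_eqI_monic:
  fixes D E :: "'n::finite diffop"
  assumes "\<And>n. monic n (P n)" "\<And>n. P n \<cdot> D = P n \<cdot> E"
  shows "D = E"
proof (rule diffop_eqI)
  fix Q :: "'n pmat"
  show "Q \<cdot> D = Q \<cdot> E"
    using assms(1)
  proof (induction Q rule: monic_sequence_induct)
    case zero
    then show ?case by (simp add: diffop_apply_def)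
  next
    case (add A n R)
    then show ?case by (simp add: diffop_apply_add_left diffop_apply_const_left assms(2))
  qed
qed

section \<open>Operators intertwining two monic sequences\<close>

definition intertwines ::
    "(nat \<Rightarrow> 'n::finite pmat) \<Rightarrow> 'n diffop \<Rightarrow> (nat \<Rightarrow> 'n pmat) \<Rightarrow> bool" where
  "intertwines P V Q \<longleftrightarrow> (\<forall>n. \<exists>A. P n \<cdot> V = pmat_const A ** Q n)"

lemma weight_algebra_iff:
  "D \<in> weight_algebra a b W \<longleftrightarrow> intertwines (mops a b W) D (mops a b W)"
  by (simp add: weight_algebra_def intertwines_def)

lemma intertwines_mult:
  assumes "intertwines P V Q" "intertwines Q N R"
  shows "intertwines P (V * N) R"
  unfolding intertwines_def
proof
  fix n
  obtain A B where "P n \<cdot> V = pmat_const A ** Q n" "Q n \<cdot> N = pmat_const B ** R n"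
    using assms unfolding intertwines_def by metis
  then have "P n \<cdot> (V * N) = pmat_const (A ** B) ** R n"
    by (simp add: diffop_apply_mult diffop_apply_const_left pmat_const_mult matrix_mul_assoc)
  then show "\<exists>A. P n \<cdot> (V * N) = pmat_const A ** R n" by blast
qed

lemma invertible_of_left_cancel:
  fixes A :: "'a::field ^ 'n::finite ^ 'n"
  assumes "\<And>M :: 'a ^ 'n ^ 'n. M ** A = 0 \<Longrightarrow> M = 0"
  obtains B where "B ** A = mat 1" "A ** B = mat 1"
proof -
  have "x = 0" if "x v* A = 0" for x
  proof -
    (* The matrix whose rows all equal x. *)
    have "(\<chi> i. x) ** A = 0"
      using that by (simp add: vec_eq_iff matrix_matrix_mult_def vector_matrix_mult_def mult.commute)
    then have "(\<chi> i. x) = (0 :: 'a ^ 'n ^ 'n)" by (rule assms)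
    then show ?thesis by (simp add: vec_eq_iff)
  qed
  then obtain C where "C ** transpose A = mat 1"
    using matrix_left_invertible_ker[of "transpose A"] by (auto simp: transpose_matrix_vector)
  then have "A ** transpose C = mat 1"
    by (metis matrix_transpose_mul transpose_mat transpose_transpose)
  then show ?thesis
    using that matrix_left_right_inverse by metis
qed

text \<open>
  If \<open>M A = 0\<close> then \<open>V\<close> kills \<open>M P\<close>. As \<open>V\<close> has trivial kernel, \<open>M P = 0\<close>, and \<open>M\<close> is the
  leading coefficient of \<open>M P\<close>.
\<close>

lemma intertwining_matrix_invertible:
  fixes A :: "'n::finite cmat"
  assumes "degree_preserving V" "monic n P" "P \<cdot> V = pmat_const A ** Q"
  obtains B where "B ** A = mat 1" "A ** B = mat 1"
proof (rule invertible_of_left_cancel)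
  fix M :: "'n cmat" assume "M ** A = 0"
  then have "(pmat_const M ** P) \<cdot> V = 0"
    using assms(3) by (simp add: diffop_apply_const_left matrix_mul_assoc flip: pmat_const_mult)
  then have "pmat_const M ** P = 0"
    using assms(1) by (simp add: degree_preserving_def)
  then have "M ** pmat_coeff P n = 0"
    by (metis pmat_coeff_const_mult pmat_coeff_zero)
  then show "M = 0" using assms(2) by (simp add: monic_iff)
qed (rule that)

lemma pmat_const_cancel:
  assumes "B ** A = mat 1"
  shows "pmat_const B ** (pmat_const A ** P) = P"
  by (simp add: assms matrix_mul_assoc pmat_const_mat pCons_one flip: pmat_const_mult)

text \<open>Inverting \<open>A\<close> in \<open>P\<^sub>n \<cdot> V = A Q\<^sub>n\<close> shows how the second factor acts on \<open>Q\<^sub>n\<close>.\<close>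

lemma intertwines_factor:
  assumes "\<And>n. monic n (P n)" "degree_preserving V" "intertwines P V Q"
    and "intertwines P (V * N) R"
  shows "intertwines Q N R"
  unfolding intertwines_def
proof
  fix n
  obtain A L where A: "P n \<cdot> V = pmat_const A ** Q n"
    and L: "P n \<cdot> (V * N) = pmat_const L ** R n"
    using assms(3,4) unfolding intertwines_def by metis
  obtain B where B: "B ** A = mat 1"
    using intertwining_matrix_invertible[OF assms(2,1) A] by blast
  have "Q n \<cdot> N = pmat_const B ** (pmat_const A ** (Q n \<cdot> N))"
    by (simp add: pmat_const_cancel[OF B])
  also have "\<dots> = pmat_const B ** (P n \<cdot> (V * N))"
    by (simp add: A diffop_apply_mult diffop_apply_const_left)
  also have "\<dots> = pmat_const (B ** L) ** R n"
    by (simp add: L pmat_const_mult matrix_mul_assoc)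
  finally show "\<exists>A. Q n \<cdot> N = pmat_const A ** R n" by blast
qed

text \<open>
  The matrix \<open>A\<close> in \<open>P\<^sub>n \<cdot> V = A Q\<^sub>n\<close> is invertible, so \<open>Q\<^sub>n\<close> lies in the image of \<open>V\<close> and
  \<open>V * D\<close> determines the values of \<open>D\<close> on a basis.
\<close>

lemma intertwining_left_cancel:
  assumes "\<And>n. monic n (P n)" "\<And>n. monic n (Q n)" "degree_preserving V" "intertwines P V Q"
    and eq: "V * D = V * E"
  shows "D = E"
proof (rule diffop_eqI_monic[OF assms(2)])
  fix n
  obtain A where A: "P n \<cdot> V = pmat_const A ** Q n"
    using assms(4) unfolding intertwines_def by metis
  obtain B where B: "B ** A = mat 1"
    using intertwining_matrix_invertible[OF assms(3,1) A] by blast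
  have "Q n \<cdot> X = pmat_const B ** (P n \<cdot> (V * X))" for X
    by (simp add: A diffop_apply_mult diffop_apply_const_left pmat_const_cancel[OF B])
  then show "Q n \<cdot> D = Q n \<cdot> E" by (simp add: eq)
qed

lemma degree_preserving_right_cancel:
  fixes D E :: "'n::finite diffop"
  assumes "degree_preserving N" "D * N = E * N"
  shows "D = E"
proof -
  have "P \<cdot> (D - E) = 0" for P :: "'n pmat"
  proof -
    have "P \<cdot> (D - E) \<cdot> N = P \<cdot> ((D - E) * N)" by (simp add: diffop_apply_mult)
    then have "P \<cdot> (D - E) \<cdot> N = 0" by (simp add: assms(2) left_diff_distrib)
    then show ?thesis using assms(1) by (simp add: degree_preserving_def)
  qed
  then have "D - E = 0" by (intro diffop_eqI) simp
  then show ?thesis by simp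
qed

text \<open>
  For \<open>E\<close> in the second algebra, \<open>V E N\<close> and \<open>V N\<close> lie in the first one. Cancelling \<open>V\<close> and
  \<open>N\<close> from \<open>(V E N) (V N) = (V N) (V E N)\<close> shows that \<open>E\<close> commutes with \<open>N V\<close>; doing the
  same with \<open>(V D N) (V E N) = (V E N) (V D N)\<close> and moving \<open>N V\<close> to the left leaves
  \<open>N V D E = N V E D\<close>.
\<close>

lemma commute_transfer:
  assumes P: "\<And>n. monic n (P n)" and Q: "\<And>n. monic n (Q n)"
    and V: "degree_preserving V" "intertwines P V Q"
    and N: "degree_preserving N" "intertwines Q N P"
    and comm: "\<And>D E. intertwines P D P \<Longrightarrow> intertwines P E P \<Longrightarrow> D * E = E * D"
    and D: "intertwines Q D Q" and E: "intertwines Q E Q"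
  shows "D * E = E * D"
proof -
  note Vl = intertwining_left_cancel[OF P Q V] and Nl = intertwining_left_cancel[OF Q P N]
    and Nr = degree_preserving_right_cancel[OF N(1)]
  have lift: "intertwines P (V * X * N) P" if "intertwines Q X Q" for X
    using intertwines_mult V(2) N(2) that by blast
  have central: "X * (N * V) = N * V * X" if X: "intertwines Q X Q" for X
  proof -
    have "V * X * N * (V * N) = V * N * (V * X * N)"
      using comm[OF lift[OF X] intertwines_mult[OF V(2) N(2)]] .
    then have "V * (X * (N * V)) * N = V * (N * V * X) * N" by (simp add: mult.assoc)
    then show ?thesis using Vl Nr by blast
  qed
  have "V * D * N * (V * E * N) = V * E * N * (V * D * N)"
    by (rule comm[OF lift[OF D] lift[OF E]])
  then have "V * (D * (N * V) * E) * N = V * (E * (N * V) * D) * N" by (simp add: mult.assoc)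
  then have "D * (N * V) * E = E * (N * V) * D" using Vl Nr by blast
  then have "N * (V * (D * E)) = N * (V * (E * D))"
    by (simp add: central[OF D] central[OF E]) (simp add: mult.assoc)
  then show ?thesis using Nl Vl by blast
qed

section \<open>The matrix-valued inner product of a weight\<close>

lemma bounded_linear_sandwich: "bounded_linear (\<lambda>X :: 'n::finite cmat. A ** X ** B)"
  unfolding linear_conv_bounded_linear[symmetric]
  by (rule linearI)
    (simp_all add: vec_eq_iff matrix_matrix_mult_def sum.distrib algebra_simps
      scaleR_sum_right sum_distrib_left sum_distrib_right)

lemma bounded_linear_conj_transpose: "bounded_linear (conj_transpose :: 'n::finite cmat \<Rightarrow> _)"
  unfolding linear_conv_bounded_linear[symmetric]
  by (rule linearI) (simp_all add: vec_eq_iff conj_transpose_def)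

definition quad_form :: "complex ^ 'n::finite \<Rightarrow> 'n cmat \<Rightarrow> complex" where
  "quad_form v A = (\<Sum>i\<in>UNIV. \<Sum>j\<in>UNIV. cnj (v $ i) * A $ i $ j * v $ j)"

lemma pos_def_quad_form: "pos_def A \<Longrightarrow> v \<noteq> 0 \<Longrightarrow> 0 < Re (quad_form v A)"
  unfolding pos_def_def quad_form_def by blast

lemma bounded_linear_quad_form: "bounded_linear (\<lambda>A. Re (quad_form v A))"
  unfolding linear_conv_bounded_linear[symmetric] quad_form_def
  by (rule linearI)
    (simp_all add: sum.distrib algebra_simps scaleR_sum_right sum_distrib_left)

lemma quad_form_mult_vec: "quad_form v A = (\<Sum>i\<in>UNIV. cnj (v $ i) * (A *v v) $ i)"
  by (simp add: quad_form_def matrix_vector_mult_def sum_distrib_left mult.assoc)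

lemma adjoint_mult_vec:
  fixes A :: "'n::finite cmat"
  shows "(\<Sum>i\<in>UNIV. cnj (v $ i) * (A *v w) $ i) =
    (\<Sum>i\<in>UNIV. cnj ((conj_transpose A *v v) $ i) * w $ i)"
proof -
  have "(\<Sum>i\<in>UNIV. cnj (v $ i) * (A *v w) $ i) =
      (\<Sum>i\<in>UNIV. \<Sum>j\<in>UNIV. cnj (v $ i) * A $ i $ j * w $ j)"
    by (simp add: matrix_vector_mult_def sum_distrib_left mult.assoc)
  also have "\<dots> = (\<Sum>j\<in>UNIV. \<Sum>i\<in>UNIV. cnj (v $ i) * A $ i $ j * w $ j)"
    by (rule sum.swap)
  also have "\<dots> = (\<Sum>i\<in>UNIV. cnj ((conj_transpose A *v v) $ i) * w $ i)"
    by (simp add: matrix_vector_mult_def conj_transpose_def sum_distrib_left ac_simps)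
  finally show ?thesis .
qed

lemma quad_form_congruence:
  "quad_form v (A ** X ** conj_transpose A) = quad_form (conj_transpose A *v v) X"
  by (simp add: quad_form_mult_vec adjoint_mult_vec matrix_vector_mul_assoc[symmetric])

lemma conj_transpose_add: "conj_transpose (A + B) = conj_transpose A + conj_transpose B"
  by (simp add: vec_eq_iff conj_transpose_def)

lemma conj_transpose_zero [simp]: "conj_transpose 0 = 0"
  by (simp add: vec_eq_iff conj_transpose_def)

lemma conj_transpose_mult: "conj_transpose (A ** B) = conj_transpose B ** conj_transpose A"
  by (simp add: vec_eq_iff conj_transpose_def matrix_matrix_mult_def mult.commute)

lemma conj_transpose_involution [simp]: "conj_transpose (conj_transpose A) = A"
  by (simp add: vec_eq_iff conj_transpose_def)

lemma pmat_eval_add: "pmat_eval (P + Q) x = pmat_eval P x + pmat_eval Q x"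
  by (simp add: pmat_eval_def vec_eq_iff)

lemma pmat_eval_const_mult: "pmat_eval (pmat_const A ** P) x = A ** pmat_eval P x"
  by (simp add: pmat_eval_def pmat_const_def vec_eq_iff matrix_matrix_mult_def poly_sum)

lemma pmat_eval_eq_sum_coeff:
  "pmat_eval P (of_real x) = (\<Sum>k\<le>pmat_degree P. x ^ k *\<^sub>R pmat_coeff P k)"
proof -
  have "poly (P $ i $ j) (of_real x) =
      (\<Sum>k\<le>pmat_degree P. x ^ k *\<^sub>R coeff (P $ i $ j) k)" for i j
  proof -
    have "degree (P $ i $ j) \<le> pmat_degree P"
      unfolding pmat_degree_def by (intro Max_ge) (auto simp: image_iff)
    then have "poly (P $ i $ j) (of_real x) =
        (\<Sum>k\<le>pmat_degree P. coeff (P $ i $ j) k * of_real x ^ k)"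
      by (subst poly_altdef, intro sum.mono_neutral_left) (auto simp: coeff_eq_0)
    then show ?thesis by (simp add: scaleR_conv_of_real mult.commute)
  qed
  then show ?thesis by (simp add: vec_eq_iff pmat_eval_def pmat_coeff_def)
qed

context
  fixes a b :: ereal and W :: "real \<Rightarrow> complex ^ 'n::finite ^ 'n"
  assumes W: "weight_matrix a b W"
begin

abbreviation (input) interval where "interval \<equiv> einterval a b"

abbreviation (input) integrand where
  "integrand P Q x \<equiv> pmat_eval P (of_real x) ** W x ** conj_transpose (pmat_eval Q (of_real x))"

abbreviation (input) inner_product where "inner_product \<equiv> weight_inner a b W"

text \<open>
  Expanding both polynomials in powers of \<open>x\<close> writes the integrand as a sum of bounded linear
  images of the functions \<open>x\<^sup>k W(x)\<close>, whose integrals are the moments of the weight.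
\<close>

lemma integrable_integrand: "set_integrable lborel interval (integrand P Q)"
proof -
  interpret ct: bounded_linear "conj_transpose :: 'n cmat \<Rightarrow> _"
    by (rule bounded_linear_conj_transpose)
  have scale: "(r *\<^sub>R A) ** X = r *\<^sub>R (A ** X)" "A ** (r *\<^sub>R X) = r *\<^sub>R (A ** X)"
    for r and A X :: "'n cmat"
    by (simp_all add: vec_eq_iff matrix_matrix_mult_def scaleR_sum_right)
  have "integrand P Q x = (\<Sum>l\<le>pmat_degree Q. \<Sum>k\<le>pmat_degree P.
      pmat_coeff P k ** (x ^ (k + l) *\<^sub>R W x) ** conj_transpose (pmat_coeff Q l))" for x
    unfolding pmat_eval_eq_sum_coeff ct.sum ct.scaleR mm_sum_left
    by (simp add: mm_sum_right scale power_add scaleR_sum_right mult.commute)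
  moreover have "set_integrable lborel interval
      (\<lambda>x. A ** (x ^ k *\<^sub>R W x) ** B)" for A B :: "'n cmat" and k
  proof -
    have "set_integrable lborel interval (\<lambda>x. x ^ k *\<^sub>R W x)"
      using W by (simp add: weight_matrix_def finite_moments_def)
    from integrable_bounded_linear[OF bounded_linear_sandwich[of A B] this[unfolded set_integrable_def]]
    show ?thesis
      by (simp add: set_integrable_def scale)
  qed
  ultimately show ?thesis
    by (auto simp only: set_integrable_def scaleR_sum_right intro!: Bochner_Integration.integrable_sum)
qed

lemma inner_add_left: "inner_product (P + Q) R = inner_product P R + inner_product Q R"
  using set_integral_add(2)[OF integrable_integrand integrable_integrand]
  by (simp add: weight_inner_def pmat_eval_add mm_add_right)

lemma inner_bounded_linear:
  assumes "bounded_linear f"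
  shows "f (inner_product P Q) = (LINT x:interval|lborel. f (integrand P Q x))"
proof -
  interpret f: bounded_linear f by fact
  show ?thesis
    using integral_bounded_linear[OF assms integrable_integrand[unfolded set_integrable_def], of P Q]
    by (simp add: weight_inner_def set_lebesgue_integral_def f.scaleR)
qed

lemma inner_const_left: "inner_product (pmat_const A ** P) Q = A ** inner_product P Q"
  using inner_bounded_linear[OF bounded_linear_sandwich[of A "mat 1"], of P Q]
  by (simp add: weight_inner_def pmat_eval_const_mult matrix_mul_assoc)

lemma AE_pos_def: "AE x in lborel. x \<in> interval \<longrightarrow> pos_def (W x)"
  using W by (simp add: weight_matrix_def)

lemma inner_hermitian: "conj_transpose (inner_product P Q) = inner_product Q P"
proof -
  have int: "integrable lborel (\<lambda>x. indicator interval x *\<^sub>R integrand R S x)" for R S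
    using integrable_integrand by (simp add: set_integrable_def)
  have "conj_transpose (inner_product P Q) =
      (LINT x|lborel. conj_transpose (indicator interval x *\<^sub>R integrand P Q x))"
    unfolding weight_inner_def set_lebesgue_integral_def
    by (rule integral_bounded_linear[OF bounded_linear_conj_transpose int, symmetric])
  also have "\<dots> = inner_product Q P"
    unfolding weight_inner_def set_lebesgue_integral_def
  proof (rule integral_cong_AE)
    show "AE x in lborel. conj_transpose (indicator interval x *\<^sub>R integrand P Q x) =
        indicator interval x *\<^sub>R integrand Q P x"
      using AE_pos_def
      by eventually_elim
        (auto simp: pos_def_def conj_transpose_mult matrix_mul_assoc indicator_def)
    show "(\<lambda>x. conj_transpose (indicator interval x *\<^sub>R integrand P Q x)) \<in> borel_measurable lborel"
      by (rule borel_measurable_integrable,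
          rule integrable_bounded_linear[OF bounded_linear_conj_transpose int])
    show "(\<lambda>x. indicator interval x *\<^sub>R integrand Q P x) \<in> borel_measurable lborel"
      by (rule borel_measurable_integrable[OF int])
  qed
  finally show ?thesis .
qed

lemma inner_add_right: "inner_product P (Q + R) = inner_product P Q + inner_product P R"
  using inner_add_left[of Q R P]
  by (metis inner_hermitian conj_transpose_add)

lemma inner_const_right:
  "inner_product P (pmat_const A ** Q) = inner_product P Q ** conj_transpose A"
  by (metis inner_hermitian inner_const_left conj_transpose_mult)

lemma inner_diff_left: "inner_product (P - Q) R = inner_product P R - inner_product Q R"
  using inner_add_left[of "P - Q" Q R] by simp

lemma inner_zero_right [simp]: "inner_product P 0 = 0"
  using inner_add_right[of P 0 0] by simp

lemma interval_not_AE_empty: "\<not> (AE x in lborel. x \<notin> interval)"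
proof
  assume ae: "AE x in lborel. x \<notin> interval"
  have "a < b" using W by (simp add: weight_matrix_def)
  then obtain c where "c \<in> interval" using einterval_nonempty by blast
  then obtain e where e: "e > 0" "cball c e \<subseteq> interval"
    using open_contains_cball open_einterval by metis
  have "{c - e..c + e} \<in> null_sets lborel"
    using ae e(2)
    by (subst AE_iff_null_sets)
      (auto elim!: eventually_mono simp: subset_iff cball_def dist_real_def abs_le_iff)
  then show False
    using e(1) by (simp add: null_sets_def)
qed

text \<open>
  If \<open>v\<^sup>* \<langle>P, P\<rangle> v\<close> vanishes then, as \<open>W\<close> is positive definite almost everywhere, the row
  polynomial \<open>v\<^sup>* P\<close> vanishes almost everywhere on the interval. A nonzero polynomial has only
  finitely many zeros, and the interval is not a null set.
\<close>

lemma inner_definite: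
  assumes "Re (quad_form v (inner_product P P)) = 0"
  shows "(\<Sum>j\<in>UNIV. smult (cnj (v $ j)) (P $ j $ k)) = 0"
proof (rule ccontr)
  define u where "u x = conj_transpose (pmat_eval P (of_real x)) *v v" for x :: real
  define q where "q = (\<Sum>j\<in>UNIV. smult (cnj (v $ j)) (P $ j $ k))"
  let ?f = "\<lambda>x. indicator interval x *\<^sub>R Re (quad_form v (integrand P P x))"
  assume "(\<Sum>j\<in>UNIV. smult (cnj (v $ j)) (P $ j $ k)) \<noteq> 0"
  then have "finite {z. poly q z = 0}"
    by (simp add: poly_roots_finite q_def)
  then have "finite (complex_of_real -` {z. poly q z = 0})"
    by (rule finite_vimageI) (simp add: inj_def)
  then have "complex_of_real -` {z. poly q z = 0} \<in> null_sets lborel"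
    by (rule finite_imp_null_set_lborel)
  then have not_root: "AE x in lborel. poly q (complex_of_real x) \<noteq> 0"
    by (auto dest!: AE_not_in)
  have u_root: "poly q (of_real x) = 0" if "u x = 0" for x
  proof -
    have "cnj (u x $ k) = poly q (of_real x)"
      by (simp add: u_def q_def poly_sum matrix_vector_mult_def conj_transpose_def pmat_eval_def
          mult.commute)
    then show ?thesis using that by simp
  qed
  have quad: "quad_form v (integrand P P x) = quad_form (u x) (W x)" for x
    by (simp add: u_def quad_form_congruence)
  have "integrable lborel (\<lambda>x. Re (quad_form v (indicator interval x *\<^sub>R integrand P P x)))"
    by (rule integrable_bounded_linear[OF bounded_linear_quad_form])
      (use integrable_integrand in \<open>simp add: set_integrable_def\<close>)
  then have int: "integrable lborel ?f"
    by (simp only: linear_cmul[OF bounded_linear.linear[OF bounded_linear_quad_form]])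
  have pos: "AE x in lborel. x \<in> interval \<longrightarrow> u x \<noteq> 0 \<longrightarrow> 0 < ?f x"
    using AE_pos_def
    by eventually_elim (simp add: quad pos_def_quad_form)
  have zero: "quad_form 0 X = 0" for X :: "'n cmat"
    by (simp add: quad_form_def)
  have "AE x in lborel. 0 \<le> ?f x"
    using pos by eventually_elim (auto simp: indicator_def quad zero less_imp_le)
  moreover have "integral\<^sup>L lborel ?f = 0"
    using assms inner_bounded_linear[OF bounded_linear_quad_form, of v P P]
    by (simp add: set_lebesgue_integral_def)
  ultimately have "AE x in lborel. ?f x = 0"
    using integral_nonneg_eq_0_iff_AE[OF int] by blast
  then have "AE x in lborel. x \<notin> interval"
    using pos not_root by eventually_elim (use u_root in force)
  then show False using interval_not_AE_empty by contradiction
qed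

lemma inner_self_eq_zero:
  assumes "inner_product P P = 0"
  shows "P = 0"
proof -
  have "P $ i $ k = 0" for i k
  proof -
    have "smult (cnj (axis i 1 $ j)) (P $ j $ k) = (if j = i then P $ j $ k else 0)" for j
      by (simp add: axis_def)
    then show ?thesis
      using inner_definite[of "axis i 1" P k] assms by (simp add: quad_form_def)
  qed
  then show ?thesis by (simp add: vec_eq_iff)
qed

text \<open>
  For \<open>v\<close> in the kernel of \<open>\<langle>P, P\<rangle>\<close> the row polynomial \<open>v\<^sup>* P\<close> is zero, and its leading
  coefficient is \<open>v\<^sup>*\<close>.
\<close>

lemma inner_monic_invertible:
  assumes "monic n P"
  obtains B where "B ** inner_product P P = mat 1"
proof -
  have "v = 0" if "inner_product P P *v v = 0" for v
  proof -
    have "cnj (v $ k) = 0" for k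
    proof -
      have "quad_form v (inner_product P P) = 0"
        using that by (simp add: quad_form_mult_vec)
      then have "coeff (\<Sum>j\<in>UNIV. smult (cnj (v $ j)) (P $ j $ k)) n = 0"
        by (simp add: inner_definite)
      moreover have "coeff (P $ j $ k) n = (if j = k then 1 else 0)" for j
        using assms by (auto simp: monic_iff pmat_coeff_def vec_eq_iff mat_def)
      ultimately show ?thesis
        by (simp add: coeff_sum if_distrib cong: if_cong)
    qed
    then show ?thesis by (simp add: vec_eq_iff)
  qed
  then show ?thesis using matrix_left_invertible_ker that by blast
qed

section \<open>Existence and uniqueness of the monic orthogonal polynomials\<close>

text \<open>
  One step of the Gram--Schmidt process: the projection of \<open>x\<^sup>m\<close> already yields the monic
  \<open>P\<close> of degree \<open>m\<close> that is orthogonal to all lower degrees, and \<open>\<langle>P, P\<rangle>\<close> is invertible, so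
  the component along \<open>P\<close> can be subtracted.
\<close>

lemma orthogonal_projection:
  "\<exists>S. degree_below m S \<and> (\<forall>Q. degree_below m Q \<longrightarrow> inner_product (R - S) Q = 0)"
proof (induction m arbitrary: R)
  case 0
  show ?case by (rule exI[of _ 0]) (simp add: degree_below_0)
next
  case (Suc m)
  obtain T where T: "degree_below m T"
    "\<And>Q. degree_below m Q \<Longrightarrow> inner_product (mat (monom 1 m) - T) Q = 0"
    using Suc.IH by blast
  define P where "P = mat (monom 1 m) - T"
  have P: "monic m P" unfolding P_def by (rule monic_diff_below[OF monic_monom T(1)])
  have P0: "inner_product P Q = 0" if "degree_below m Q" for Q
    using T(2)[OF that] by (simp add: P_def)
  obtain S where S: "degree_below m S"
    "\<And>Q. degree_below m Q \<Longrightarrow> inner_product (R - S) Q = 0"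
    using Suc.IH by blast
  obtain B where B: "B ** inner_product P P = mat 1"
    using inner_monic_invertible[OF P] by blast
  define C where "C = inner_product (R - S) P ** B"
  let ?S = "S + pmat_const C ** P"
  have split: "inner_product (R - ?S) Q = inner_product (R - S) Q - C ** inner_product P Q" for Q
    using inner_diff_left[of "R - S" "pmat_const C ** P" Q]
    by (simp add: inner_const_left algebra_simps)
  have "inner_product (R - ?S) P = 0"
    unfolding split by (simp add: C_def B flip: matrix_mul_assoc)
  moreover have "inner_product (R - ?S) Q = 0" if "degree_below m Q" for Q
    by (simp add: split S(2) P0 that)
  ultimately have "inner_product (R - ?S) Q = 0" if Q: "degree_below (Suc m) Q" for Q
    using degree_below_Suc_split[OF Q P] by (metis inner_add_right inner_const_right mm_zero(2) add_0)
  moreover have "degree_below (Suc m) ?S"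
    using S(1) P by (intro degree_below_add monic_degree_below) (auto intro: degree_below_mono)
  ultimately show ?case by blast
qed

text \<open>
  Orthogonality to all lower degrees is linear in the second argument, which is the form that
  both the construction and the uniqueness proof use. The other half of the orthogonality
  relations comes from the hermitian symmetry.
\<close>

lemma monic_orthogonal_iff:
  "monic_orthogonal a b W P \<longleftrightarrow>
    (\<forall>n. monic n (P n) \<and> (\<forall>Q. degree_below n Q \<longrightarrow> inner_product (P n) Q = 0))"
  (is "_ \<longleftrightarrow> ?R")
proof
  assume "monic_orthogonal a b W P"
  then have P: "\<And>n. monic n (P n)" "\<And>n m. n \<noteq> m \<Longrightarrow> inner_product (P n) (P m) = 0"
    by (auto simp: monic_orthogonal_def monic_def)
  have "inner_product (P n) Q = 0" if "degree_below m Q" "m \<le> n" for m n Q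
    using that
  proof (induction m arbitrary: Q)
    case 0
    then show ?case by (simp add: degree_below_0)
  next
    case (Suc m)
    then show ?case
      using degree_below_Suc_split[OF Suc.prems(1) P(1)] P(2)[of n m]
      by (metis Suc_le_lessD add_0 inner_add_right inner_const_right less_imp_le less_irrefl mm_zero(2))
  qed
  then show ?R using P(1) by blast
next
  assume R: ?R
  have lower: "inner_product (P n) (P m) = 0" if "m < n" for n m
    using R that monic_degree_below[of m "P m" n "mat 1"]
    by (simp add: pmat_const_mat pCons_one)
  have "inner_product (P n) (P m) = 0" if "n \<noteq> m" for n m
  proof (cases "m < n")
    case False
    then have "inner_product (P m) (P n) = 0" using lower that by simp
    then show ?thesis
      using inner_hermitian[of "P m" "P n"]
        conj_transpose_zero by metis
  qed (rule lower)
  then show "monic_orthogonal a b W P"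
    using R by (auto simp: monic_orthogonal_def monic_def)
qed

lemma monic_orthogonal_exists: "\<exists>P. monic_orthogonal a b W P"
proof -
  have "\<exists>P. monic n P \<and> (\<forall>Q. degree_below n Q \<longrightarrow> inner_product P Q = 0)" for n
    using orthogonal_projection[of n "mat (monom 1 n)"] monic_diff_below[OF monic_monom] by blast
  then show ?thesis unfolding monic_orthogonal_iff by metis
qed

lemma monic_orthogonal_unique:
  assumes "monic_orthogonal a b W P" "monic_orthogonal a b W Q"
  shows "P = Q"
proof
  fix n
  (* The difference has degree below n, and both terms are orthogonal to such polynomials. *)
  have "degree_below n (P n - Q n)"
    using assms by (intro monic_diff_monic) (auto simp: monic_orthogonal_iff)
  then have "inner_product (P n - Q n) (P n - Q n) = 0"
    using assms by (simp add: monic_orthogonal_iff inner_diff_left)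
  then show "P n = Q n" using inner_self_eq_zero by fastforce
qed

lemma monic_mops: "monic n (mops a b W n)"
proof -
  have "\<exists>!P. monic_orthogonal a b W P"
    by (rule ex_ex1I[OF monic_orthogonal_exists monic_orthogonal_unique])
  from theI'[OF this] have "monic_orthogonal a b W (mops a b W)"
    unfolding mops_def .
  then show ?thesis by (simp add: monic_orthogonal_iff)
qed

end

section \<open>Darboux transformations preserve commutativity\<close>

theorem theorem3p10:
  fixes W W' :: "real \<Rightarrow> complex ^ 'n::finite ^ 'n" and a b :: ereal
  assumes "weight_matrix a b W" and "weight_matrix a b W'"
    and "darboux_transformation a b W W'"
  shows "commutative_diffop_algebra (weight_algebra a b W) \<longleftrightarrow>
         commutative_diffop_algebra (weight_algebra a b W')"
proof -
  let ?P = "mops a b W" and ?Q = "mops a b W'"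
  note P = monic_mops[OF assms(1)] and Q = monic_mops[OF assms(2)]
  obtain V N A where D: "V * N \<in> weight_algebra a b W"
    and VN: "degree_preserving V" "degree_preserving N"
    and A: "\<forall>n. ?P n \<cdot> V = pmat_const (A n) ** ?Q n"
    using assms(3) unfolding darboux_transformation_def by auto
  have V: "intertwines ?P V ?Q" using A unfolding intertwines_def by blast
  have N: "intertwines ?Q N ?P"
    by (rule intertwines_factor[OF P VN(1) V D[unfolded weight_algebra_iff]])
  have alg: "commutative_diffop_algebra (weight_algebra a b U) \<longleftrightarrow>
      (\<forall>D E. intertwines (mops a b U) D (mops a b U) \<longrightarrow>
        intertwines (mops a b U) E (mops a b U) \<longrightarrow> D * E = E * D)"
    for U :: "real \<Rightarrow> 'n cmat"
    by (auto simp: commutative_diffop_algebra_def diffop_subalgebra_weight_algebra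
        weight_algebra_iff)
  show ?thesis
    unfolding alg
    using commute_transfer[OF P Q VN(1) V VN(2) N] commute_transfer[OF Q P VN(2) N VN(1) V]
    by blast
qed

end
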